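(* Let $K,M:\mathbb{R}^m_{\ge0}\to\mathbb{S}^n_{\succeq0}$ be continuous with $K(x)\succ0$ and $M(x)\succ0$ for every $x\in\mathbb{R}^m_{>0}$. Define, for $x\in\mathbb{R}^m_{\ge0}$ and $\epsilon>0$, $$\varphi(x):=\lambda_{\max}(M(x),K(x)),\qquad \varphi^\epsilon(x):=\lambda_{\max}(M(x),K(x)+\epsilon I).$$ Then $\varphi^\epsilon$ is continuous on $\mathbb{R}^m_{\ge0}$ for every $\epsilon>0$, and $\varphi^\epsilon$ epi-converges to $\varphi$ as $\epsilon\to0$.
   Context: $\mathbb{R}^m_{\ge0}$ and $\mathbb{R}^m_{>0}$ are the sets of vectors in $\mathbb{R}^m$ with nonnegative, respectively positive, components; $\mathbb{S}^n_{\succeq0}$ is the set of real symmetric positive semidefinite $n\times n$ matrices; $\mathrm{Ker}\,Y=\{v\in\mathbb{R}^n\mid Yv=0\}$. For $X,Y\in\mathbb{S}^n_{\succeq0}$, $$\lambda_{\max}(X,Y):=\begin{cases}\displaystyle\sup_{v\notin\mathrm{Ker}\,Y}\frac{v^\top Xv}{v^\top Yv} & (Y\neq0),\\ \infty & (X\neq0,\ Y=0),\\ 0 & (X=Y=0).\end{cases}$$ Epi-convergence: for $f:\mathbb{R}^m\to(-\infty,\infty]$, $\mathrm{epi} f=\{(x,\alpha)\in\mathbb{R}^m\times\mathbb{R}\mid f(x)\le\alpha\}$. A sequence $f^k$ epi-converges to $f$ if $\mathrm{epi} f^k$ converges to $\mathrm{epi} f$ in the Painlevé–Kuratowski sense,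 i.e. both the outer limit $\{z\mid\liminf_{k} d(z,\mathrm{epi} f^k)=0\}$ and the inner limit $\{z\mid\limsup_{k} d(z,\mathrm{epi} f^k)=0\}$ equal $\mathrm{epi} f$. A family indexed by $\epsilon>0$ epi-converges as $\epsilon\to0$ if it does so along every sequence $\epsilon_k\to0$ with $\epsilon_k>0$. Functions defined only on a subset of $\mathbb{R}^m$ are extended by $\infty$ outside it. *)

theory Defs
  imports "HOL-Analysis.Analysis"
begin

definition nonneg_orthant :: "(real ^ 'm) set" where
  "nonneg_orthant = {x. \<forall>i. 0 \<le> x $ i}"

definition pos_orthant :: "(real ^ 'm) set" where
  "pos_orthant = {x. \<forall>i. 0 < x $ i}"

definition psd_matrices :: "(real ^ 'n ^ 'n) set" where
  "psd_matrices = {A. transpose A = A \<and> (\<forall>v. 0 \<le> v \<bullet> (A *v v))}"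

definition pd_matrices :: "(real ^ 'n ^ 'n) set" where
  "pd_matrices = {A. transpose A = A \<and> (\<forall>v. v \<noteq> 0 \<longrightarrow> 0 < v \<bullet> (A *v v))}"

definition Ker :: "real ^ 'n ^ 'm \<Rightarrow> (real ^ 'n) set" where
  "Ker A = {v. A *v v = 0}"

text \<open>For positive semidefinite \<open>Y\<close>, the denominator below is positive whenever \<open>v \<notin> Ker Y\<close>.\<close>

definition lambda_max :: "real ^ 'n ^ 'n \<Rightarrow> real ^ 'n ^ 'n \<Rightarrow> ereal" where
  "lambda_max X Y =
    (if Y \<noteq> 0 then (SUP v \<in> - Ker Y. ereal ((v \<bullet> (X *v v)) / (v \<bullet> (Y *v v))))
     else if X \<noteq> 0 then \<infinity>
     else 0)"

text \<open>Unlike \<^const>\<open>infdist\<close>, which is \<open>0\<close> for the empty set, this distance to the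
  empty set is \<open>\<infinity>\<close>.\<close>

definition set_distance :: "'a::metric_space \<Rightarrow> 'a set \<Rightarrow> ereal" where
  "set_distance z S = (INF w \<in> S. ereal (dist z w))"

definition outer_limit :: "(nat \<Rightarrow> 'a::metric_space set) \<Rightarrow> 'a set" where
  "outer_limit S = {z. liminf (\<lambda>k. set_distance z (S k)) = 0}"

definition inner_limit :: "(nat \<Rightarrow> 'a::metric_space set) \<Rightarrow> 'a set" where
  "inner_limit S = {z. limsup (\<lambda>k. set_distance z (S k)) = 0}"

definition PK_converges :: "(nat \<Rightarrow> 'a::metric_space set) \<Rightarrow> 'a set \<Rightarrow> bool" where
  "PK_converges S T \<longleftrightarrow> outer_limit S = T \<and> inner_limit S = T"

definition epi :: "('a \<Rightarrow> ereal) \<Rightarrow> ('a \<times> real) set" where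
  "epi f = {(x, \<alpha>). f x \<le> ereal \<alpha>}"

definition epi_converges :: "(nat \<Rightarrow> 'a::metric_space \<Rightarrow> ereal) \<Rightarrow> ('a \<Rightarrow> ereal) \<Rightarrow> bool" where
  "epi_converges f g \<longleftrightarrow> PK_converges (\<lambda>k. epi (f k)) (epi g)"

definition epi_converges_at_0 :: "(real \<Rightarrow> 'a::metric_space \<Rightarrow> ereal) \<Rightarrow> ('a \<Rightarrow> ereal) \<Rightarrow> bool" where
  "epi_converges_at_0 F g \<longleftrightarrow>
    (\<forall>\<epsilon> :: nat \<Rightarrow> real. (\<forall>k. 0 < \<epsilon> k) \<and> \<epsilon> \<longlonglongrightarrow> 0 \<longrightarrow> epi_converges (\<lambda>k. F (\<epsilon> k)) g)"

definition extend_by_infinity :: "'a set \<Rightarrow> ('a \<Rightarrow> ereal) \<Rightarrow> 'a \<Rightarrow> ereal" where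
  "extend_by_infinity D f x = (if x \<in> D then f x else \<infinity>)"

end

(* For positive semidefinite X, Y and real a, lambda_max X Y <= a holds iff a >= 0 and a Y - X is
   positive semidefinite. Hence epi phi is contained in every epi phi^eps, which makes the inner
   limit trivial, and the constraints describing epi phi^eps pass to the limit eps -> 0 along
   convergent sequences, which bounds the outer limit. Continuity of phi^eps holds because the
   Rayleigh quotient may be maximized over the compact unit sphere, its denominator being positive. *)

theory Submission
  imports Defs
begin

section \<open>Quadratic forms of positive semidefinite matrices\<close>

lemma inner_symmetric_matrix:
  fixes A :: "real ^ 'n ^ 'n"
  assumes "transpose A = A"
  shows "v \<bullet> (A *v w) = (A *v v) \<bullet> w"
  using dot_lmul_matrix[of v A w] vector_transpose_matrix[of v A] transpose_matrix_vector[of A v] assms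
  by metis

lemma quadratic_form_add:
  fixes A :: "real ^ 'n ^ 'n"
  assumes "transpose A = A"
  shows "(v + t *\<^sub>R w) \<bullet> (A *v (v + t *\<^sub>R w))
    = v \<bullet> (A *v v) + 2 * t * (w \<bullet> (A *v v)) + t\<^sup>2 * (w \<bullet> (A *v w))"
proof -
  have "v \<bullet> (A *v w) = w \<bullet> (A *v v)"
    using inner_symmetric_matrix[OF assms] by (simp add: inner_commute)
  then show ?thesis
    by (simp add: matrix_vector_right_distrib matrix_vector_mult_scaleR inner_add_left
        inner_add_right power2_eq_square algebra_simps)
qed

text \<open>Along \<open>v + t *\<^sub>R (A *v v)\<close> the form is a nonnegative quadratic in
  \<open>t\<close> without constant term. A nonzero linear coefficient, twice the squared norm of
  \<open>A *v v\<close>, would make it negative for small negative \<open>t\<close>.\<close>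

lemma psd_quadratic_form_eq_0_imp_Ker:
  fixes A :: "real ^ 'n ^ 'n"
  assumes A: "A \<in> psd_matrices" and v: "v \<bullet> (A *v v) = 0"
  shows "v \<in> Ker A"
proof -
  define w where "w = A *v v"
  define c d where "c = w \<bullet> w" and "d = w \<bullet> (A *v w)"
  have nn: "0 \<le> u \<bullet> (A *v u)" for u
    using A by (simp add: psd_matrices_def)
  have "0 \<le> d" using nn by (simp add: d_def)
  \<comment> \<open>For \<open>d > 0\<close> the minimizer is \<open>- c / d\<close>; the shift by 1
    avoids dividing by zero when \<open>d = 0\<close> and still gives a negative value unless
    \<open>c = 0\<close>.\<close>
  define t where "t = - c / (d + 1)"
  have t: "t * (d + 1) = - c"
    using \<open>0 \<le> d\<close> by (simp add: t_def)
  have "0 \<le> 2 * t * c + t\<^sup>2 * d"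
    using nn[of "v + t *\<^sub>R w"] quadratic_form_add[of A v t w] A v
    by (simp add: psd_matrices_def c_def d_def w_def)
  then have "0 \<le> (2 * t * c + t\<^sup>2 * d) * (d + 1)\<^sup>2"
    by simp
  also have "\<dots> = 2 * c * (d + 1) * (t * (d + 1)) + (t * (d + 1))\<^sup>2 * d"
    by (simp add: power2_eq_square algebra_simps)
  also have "\<dots> = - (c\<^sup>2 * (d + 2))"
    unfolding t by (simp add: power2_eq_square algebra_simps)
  finally have "c\<^sup>2 * (d + 2) \<le> 0" by simp
  then have "c = 0"
    using \<open>0 \<le> d\<close> by (auto simp: mult_le_0_iff)
  then show ?thesis by (simp add: c_def w_def Ker_def)
qed

lemma psd_eq_0:
  fixes A :: "real ^ 'n ^ 'n"
  assumes "A \<in> psd_matrices" and "\<And>v. v \<bullet> (A *v v) \<le> 0"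
  shows "A = 0"
proof -
  have "A *v v = 0 *v v" for v
    using psd_quadratic_form_eq_0_imp_Ker[OF assms(1), of v] assms
    by (auto simp: psd_matrices_def Ker_def intro: antisym)
  then show ?thesis by (simp add: matrix_eq)
qed

section \<open>Sublevel sets of \<open>lambda_max\<close> as semidefinite inequalities\<close>

text \<open>Off \<open>Ker Y\<close> the denominators are positive and can be cleared; density
  extends the inequality to \<open>Ker Y\<close>. The condition \<open>0 \<le> \<alpha>\<close>
  matters for \<open>X = Y = 0\<close>, where the inequality on forms leaves \<alpha> free. The
  resulting conditions are stable under limits, unlike the supremum over a set that varies with
  \<open>Y\<close>.\<close>

lemma lambda_max_le_iff:
  fixes X Y :: "real ^ 'n ^ 'n"
  assumes X: "X \<in> psd_matrices" and Y: "Y \<in> psd_matrices"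
  shows "lambda_max X Y \<le> ereal \<alpha> \<longleftrightarrow> 0 \<le> \<alpha> \<and> (\<forall>v. v \<bullet> (X *v v) \<le> \<alpha> * (v \<bullet> (Y *v v)))"
proof (cases "Y = 0")
  case True
  \<comment> \<open>Here the inequality says that the form of \<open>X\<close> is nonpositive, which
    by \<open>psd_eq_0\<close> means \<open>X = 0\<close>; this matches the values \<infinity> and 0
    in the definition.\<close>
  then show ?thesis
    using psd_eq_0[OF X] by (auto simp: lambda_max_def)
next
  case False
  have Xnn: "0 \<le> v \<bullet> (X *v v)" and Ynn: "0 \<le> v \<bullet> (Y *v v)" for v
    using X Y by (auto simp: psd_matrices_def)
  have Ypos: "0 < v \<bullet> (Y *v v)" if "v \<notin> Ker Y" for v
    using psd_quadratic_form_eq_0_imp_Ker[OF Y] that Ynn[of v] by force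
  \<comment> \<open>This \<open>w\<close> serves twice: its inequality yields the sign of \<alpha>,
    and it is the direction that leads out of \<open>Ker Y\<close>.\<close>
  obtain w where w: "w \<notin> Ker Y"
    using False matrix_eq[of Y 0] by (auto simp: Ker_def)
  have "lambda_max X Y \<le> ereal \<alpha> \<longleftrightarrow> (\<forall>v. v \<notin> Ker Y \<longrightarrow> v \<bullet> (X *v v) \<le> \<alpha> * (v \<bullet> (Y *v v)))"
    using False Ypos by (auto simp: lambda_max_def SUP_le_iff divide_le_eq)
  also have "\<dots> \<longleftrightarrow> 0 \<le> \<alpha> \<and> (\<forall>v. v \<bullet> (X *v v) \<le> \<alpha> * (v \<bullet> (Y *v v)))"
  proof safe
    assume *: "\<forall>v. v \<notin> Ker Y \<longrightarrow> v \<bullet> (X *v v) \<le> \<alpha> * (v \<bullet> (Y *v v))"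
    have "0 \<le> \<alpha> * (w \<bullet> (Y *v w))"
      using * w Xnn[of w] by force
    then show "0 \<le> \<alpha>" using Ypos[OF w] by (simp add: zero_le_mult_iff)
    show "v \<bullet> (X *v v) \<le> \<alpha> * (v \<bullet> (Y *v v))" for v
    proof (cases "v \<in> Ker Y")
      case True
      \<comment> \<open>The complement of \<open>Ker Y\<close> is dense: approach \<open>v\<close> along \<open>v + t w\<close>.\<close>
      define u where "u = (\<lambda>n. v + inverse (real (Suc n)) *\<^sub>R w)"
      have "u n \<notin> Ker Y" for n
        using True w by (simp add: u_def Ker_def matrix_vector_right_distrib matrix_vector_mult_scaleR)
      then have le: "u n \<bullet> (X *v u n) \<le> \<alpha> * (u n \<bullet> (Y *v u n))" for n
        using * by blast
      have "u \<longlonglongrightarrow> v + 0 *\<^sub>R w"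
        unfolding u_def by (intro tendsto_intros LIMSEQ_inverse_real_of_nat)
      then have u: "u \<longlonglongrightarrow> v" by simp
      have Z: "(\<lambda>n. Z *v u n) \<longlonglongrightarrow> Z *v v" for Z :: "real ^ 'n ^ 'n"
        using u by (rule bounded_linear.tendsto[OF matrix_vector_mul_bounded_linear])
      show ?thesis
        by (rule LIMSEQ_le[of "\<lambda>n. u n \<bullet> (X *v u n)" _ "\<lambda>n. \<alpha> * (u n \<bullet> (Y *v u n))"])
          (use le in \<open>auto intro!: tendsto_intros u Z\<close>)
    qed (use * in blast)
  qed auto
  finally show ?thesis .
qed

section \<open>Regularization by a multiple of the identity\<close>

lemma quadratic_form_regularized:
  fixes A :: "real ^ 'n ^ 'n"
  shows "v \<bullet> ((A + \<epsilon> *\<^sub>R mat 1) *v v) = v \<bullet> (A *v v) + \<epsilon> * (v \<bullet> v)"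
  by (simp add: matrix_vector_mult_add_rdistrib scaleR_matrix_vector_assoc[symmetric] inner_add_right)

lemma psd_regularized:
  fixes A :: "real ^ 'n ^ 'n"
  assumes "A \<in> psd_matrices" and "0 \<le> \<epsilon>"
  shows "A + \<epsilon> *\<^sub>R mat 1 \<in> psd_matrices"
proof -
  have "transpose (A + \<epsilon> *\<^sub>R mat 1) = transpose A + \<epsilon> *\<^sub>R mat 1"
    by (simp add: transpose_def mat_def vec_eq_iff)
  then show ?thesis
    using assms by (simp add: psd_matrices_def quadratic_form_regularized)
qed

lemma pd_regularized:
  fixes A :: "real ^ 'n ^ 'n"
  assumes "A \<in> psd_matrices" and "0 < \<epsilon>"
  shows "A + \<epsilon> *\<^sub>R mat 1 \<in> pd_matrices"
proof -
  have "0 < v \<bullet> ((A + \<epsilon> *\<^sub>R mat 1) *v v)" if "v \<noteq> 0" for v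
    using assms that by (simp add: psd_matrices_def quadratic_form_regularized add_nonneg_pos)
  then show ?thesis
    using psd_regularized[of A \<epsilon>] assms by (simp add: psd_matrices_def pd_matrices_def)
qed

lemma pd_quadratic_form_pos:
  fixes A :: "real ^ 'n ^ 'n"
  assumes "A \<in> pd_matrices" and "v \<noteq> 0"
  shows "0 < v \<bullet> (A *v v)"
  using assms by (simp add: pd_matrices_def)

section \<open>Continuity of \<open>lambda_max\<close> for a positive definite second
  argument\<close>

text \<open>The kernel is trivial and the quotient is homogeneous of degree 0, so only unit vectors
  matter, and compactness of the sphere makes the supremum an attained real number.\<close>

lemma lambda_max_pd_eq:
  fixes X Y :: "real ^ 'n ^ 'n"
  assumes Y: "Y \<in> pd_matrices"
  shows "lambda_max X Y = ereal (SUP v \<in> sphere 0 1. (v \<bullet> (X *v v)) / (v \<bullet> (Y *v v)))"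
proof -
  let ?q = "\<lambda>v. (v \<bullet> (X *v v)) / (v \<bullet> (Y *v v))"
  let ?S = "sphere (0 :: real ^ 'n) 1"
  note Ypos = pd_quadratic_form_pos[OF Y]
  have Ker: "- Ker Y = - {0}"
    using Ypos by (force simp: Ker_def)
  have cont: "continuous_on ?S ?q"
    by (intro continuous_intros bounded_linear.continuous_on[OF matrix_vector_mul_bounded_linear])
      (metis Ypos dist_self less_irrefl mem_sphere zero_neq_one)
  have ne: "?S \<noteq> {}" by simp
  obtain u where u: "u \<in> ?S" "\<And>v. v \<in> ?S \<Longrightarrow> ?q v \<le> ?q u"
    using continuous_attains_sup[OF compact_sphere ne cont] by blast
  have SUP: "(SUP v \<in> ?S. ?q v) = ?q u"
    using u by (intro cSup_eq_maximum) auto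
  have scale: "?q v = ?q (v /\<^sub>R norm v)" if "v \<noteq> 0" for v
    using that by (simp add: matrix_vector_mult_scaleR)
  have le: "?q v \<le> ?q u" if "v \<noteq> 0" for v
    unfolding scale[OF that] using that by (intro u) simp
  \<comment> \<open>This selects the first branch of \<open>lambda_max\<close>: the unit vector
    \<open>u\<close> has a positive form.\<close>
  have "Y \<noteq> 0"
    using Ypos[of u] u(1) by (cases "u = 0") auto
  moreover have "(SUP v \<in> - {0}. ereal (?q v)) = ereal (?q u)"
  proof (rule SUP_eqI)
    have "u \<in> - {0}" using u(1) by auto
    then show "ereal (?q u) \<le> y" if "\<And>v. v \<in> - {0} \<Longrightarrow> ereal (?q v) \<le> y" for y
      by (rule that)
  qed (use le in simp)
  ultimately show ?thesis
    by (simp add: lambda_max_def Ker SUP)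
qed

text \<open>By compactness of \<open>S\<close>, joint continuity makes \<open>h y\<close> uniformly
  close to \<open>h x\<close> on \<open>S\<close> for \<open>y\<close> near \<open>x\<close>, and
  suprema differ by at most the uniform distance.\<close>

lemma continuous_on_SUP_compact:
  fixes h :: "'a::topological_space \<Rightarrow> 'b::metric_space \<Rightarrow> real"
  assumes h: "continuous_on (D \<times> S) (\<lambda>(x, v). h x v)" and S: "compact S" "S \<noteq> {}"
  shows "continuous_on D (\<lambda>x. SUP v \<in> S. h x v)"
proof -
  \<comment> \<open>A real \<open>SUP\<close> bounds its members only if the set is bounded
    above.\<close>
  have bdd: "bdd_above (h x ` S)" if "x \<in> D" for x
  proof -
    have "continuous_on S (\<lambda>v. case (x, v) of (x, v) \<Rightarrow> h x v)"
      by (rule continuous_on_compose2[OF h]) (use that in \<open>auto intro!: continuous_intros\<close>)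
    then have "compact (h x ` S)"
      using S by (intro compact_continuous_image) auto
    then show ?thesis by (intro bounded_imp_bdd_above compact_imp_bounded)
  qed
  have le: "(SUP v \<in> S. h x v) \<le> (SUP v \<in> S. h y v) + e"
    if "x \<in> D" "y \<in> D" "\<forall>v \<in> S. \<bar>h x v - h y v\<bar> \<le> e" for x y e
  proof (rule cSUP_least[OF S(2)])
    fix v assume "v \<in> S"
    then show "h x v \<le> (SUP v \<in> S. h y v) + e"
      using cSUP_upper[OF _ bdd[OF that(2)], of v] that(3) by force
  qed
  show ?thesis
    unfolding continuous_on_def
  proof (intro ballI tendstoI)
    fix x and e :: real assume x: "x \<in> D" and "0 < e"
    \<comment> \<open>The uniform estimate below is non-strict; halving \<open>e\<close> leaves room
      for the strict bound.\<close>
    then have "0 < e / 2" by simp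
    from continuous_on_prod_compactE[OF h S(1) x this] obtain U where U: "x \<in> U" "open U"
      "\<forall>y \<in> U \<inter> D. \<forall>v \<in> S. dist (h y v) (h x v) \<le> e / 2"
      by (auto simp: split_def)
    have "dist (SUP v \<in> S. h y v) (SUP v \<in> S. h x v) < e" if "y \<in> U" "y \<in> D" for y
    proof -
      have 1: "\<forall>v \<in> S. \<bar>h y v - h x v\<bar> \<le> e / 2"
        using U(3) that unfolding dist_real_def by blast
      then have 2: "\<forall>v \<in> S. \<bar>h x v - h y v\<bar> \<le> e / 2"
        by (simp only: abs_minus_commute)
      have "(SUP v \<in> S. h y v) \<le> (SUP v \<in> S. h x v) + e / 2"
        by (rule le[OF that(2) x 1])
      moreover have "(SUP v \<in> S. h x v) \<le> (SUP v \<in> S. h y v) + e / 2"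
        by (rule le[OF x that(2) 2])
      ultimately show ?thesis
        unfolding dist_real_def using \<open>0 < e\<close> by linarith
    qed
    then show "\<forall>\<^sub>F y in at x within D. dist (SUP v \<in> S. h y v) (SUP v \<in> S. h x v) < e"
      using U by (auto simp: eventually_at_topological)
  qed
qed

lemma continuous_on_matrix_vector_mult [continuous_intros]:
  fixes A :: "'a::topological_space \<Rightarrow> real ^ 'n ^ 'm"
  assumes "continuous_on S A" "continuous_on S v"
  shows "continuous_on S (\<lambda>x. A x *v v x)"
  unfolding matrix_vector_mult_def using assms by (auto intro!: continuous_intros)

lemma continuous_on_lambda_max:
  fixes X Y :: "'a::topological_space \<Rightarrow> real ^ 'n ^ 'n"
  assumes X: "continuous_on D X" and Y: "continuous_on D Y" and pd: "\<And>x. x \<in> D \<Longrightarrow> Y x \<in> pd_matrices"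
  shows "continuous_on D (\<lambda>x. lambda_max (X x) (Y x))"
proof -
  \<comment> \<open>Both matrices are lifted to the product so that the quotient is jointly
    continuous in point and vector.\<close>
  have X': "continuous_on (D \<times> T) (\<lambda>p. X (fst p))" and Y': "continuous_on (D \<times> T) (\<lambda>p. Y (fst p))"
    for T :: "(real ^ 'n) set"
    by (auto intro!: continuous_on_compose2[OF X] continuous_on_compose2[OF Y] continuous_intros)
  have "continuous_on D (\<lambda>x. ereal (SUP v \<in> sphere 0 1. (v \<bullet> (X x *v v)) / (v \<bullet> (Y x *v v))))"
  proof (intro continuous_on_ereal continuous_on_SUP_compact)
    have "snd p \<bullet> (Y (fst p) *v snd p) \<noteq> 0" if "p \<in> D \<times> sphere 0 1" for p
    proof -
      have "Y (fst p) \<in> pd_matrices" and "snd p \<noteq> 0"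
        using pd that by (auto simp: mem_Times_iff)
      then show ?thesis using pd_quadratic_form_pos by force
    qed
    then show "continuous_on (D \<times> sphere 0 1) (\<lambda>(x, v). (v \<bullet> (X x *v v)) / (v \<bullet> (Y x *v v)))"
      unfolding split_def by (intro continuous_intros X' Y') blast
  qed auto
  then show ?thesis
    by (rule continuous_on_eq) (use pd in \<open>simp add: lambda_max_pd_eq\<close>)
qed

section \<open>Inner and outer limits of sequences of sets\<close>

lemma set_distance_nonneg: "0 \<le> set_distance z S"
  by (simp add: set_distance_def INF_greatest)

lemma set_distance_mem:
  assumes "z \<in> S"
  shows "set_distance z S = 0"
proof (rule antisym)
  show "set_distance z S \<le> 0"
    unfolding set_distance_def using assms by (rule INF_lower2) (simp add: zero_ereal_def)
qed (rule set_distance_nonneg)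

lemma inner_limit_subset_outer_limit: "inner_limit S \<subseteq> outer_limit S"
proof
  fix z assume "z \<in> inner_limit S"
  then have "limsup (\<lambda>k. set_distance z (S k)) = 0" by (simp add: inner_limit_def)
  moreover have "0 \<le> liminf (\<lambda>k. set_distance z (S k))"
    by (intro Liminf_bounded always_eventually allI set_distance_nonneg)
  ultimately show "z \<in> outer_limit S"
    using Liminf_le_Limsup[of sequentially "\<lambda>k. set_distance z (S k)"]
    by (simp add: outer_limit_def)
qed

lemma subset_inner_limit:
  assumes "\<And>k. T \<subseteq> S k"
  shows "T \<subseteq> inner_limit S"
proof
  fix z assume "z \<in> T"
  then have "set_distance z (S k) = 0" for k
    using assms by (intro set_distance_mem) blast
  then show "z \<in> inner_limit S"
    by (simp add: inner_limit_def Limsup_const)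
qed

text \<open>A zero lower limit means that arbitrarily late sets come arbitrarily close to
  \<open>z\<close>. Taking an index \<open>r j\<close> of at least \<open>j\<close> makes
  \<open>r\<close> diverge, which is what composing limits with \<open>r\<close> requires.\<close>

lemma outer_limitE:
  assumes "z \<in> outer_limit S"
  obtains r :: "nat \<Rightarrow> nat" and w where "filterlim r at_top sequentially"
    and "\<And>j. w j \<in> S (r j)" and "w \<longlonglongrightarrow> z"
proof -
  have "\<exists>k\<ge>j. \<exists>w\<in>S k. dist z w < inverse (real (Suc j))" for j
  proof (rule ccontr)
    assume "\<not> ?thesis"
    \<comment> \<open>Otherwise all sets from index \<open>j\<close> on stay at a fixed positive
      distance, and so does the lower limit.\<close>
    then have far: "inverse (real (Suc j)) \<le> dist z w" if "j \<le> k" "w \<in> S k" for k w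
      using that by force
    have "ereal (inverse (real (Suc j))) \<le> set_distance z (S k)" if "j \<le> k" for k
      unfolding set_distance_def by (intro INF_greatest) (use far that in simp)
    then have "ereal (inverse (real (Suc j))) \<le> liminf (\<lambda>k. set_distance z (S k))"
      by (intro Liminf_bounded eventually_sequentiallyI)
    then show False
      using assms by (simp add: outer_limit_def zero_ereal_def)
  qed
  then obtain r w where r: "\<And>j. j \<le> r j" and w: "\<And>j. w j \<in> S (r j)"
    and d: "\<And>j. dist z (w j) < inverse (real (Suc j))"
    by metis
  have "filterlim r at_top sequentially"
    using filterlim_ident by (rule filterlim_at_top_mono) (use r in simp)
  moreover have "(\<lambda>j. dist (w j) z) \<longlonglongrightarrow> 0"
    by (rule tendsto_sandwich[OF _ _ tendsto_const LIMSEQ_inverse_real_of_nat])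
      (use d in \<open>auto simp: dist_commute intro!: always_eventually less_imp_le\<close>)
  then have "w \<longlonglongrightarrow> z" by (rule iffD2[OF tendsto_dist_iff])
  ultimately show thesis using w by (intro that[of r w])
qed

section \<open>Continuity and epi-convergence of the regularized functions\<close>

lemma closed_nonneg_orthant: "closed (nonneg_orthant :: (real ^ 'm) set)"
  unfolding nonneg_orthant_def by (intro closed_Collect_all closed_Collect_le continuous_intros)

theorem theorem14:
  fixes K M :: "real ^ 'm \<Rightarrow> real ^ 'n ^ 'n"
    and \<phi> :: "real ^ 'm \<Rightarrow> ereal"
    and \<phi>e :: "real \<Rightarrow> real ^ 'm \<Rightarrow> ereal"
  assumes K_psd: "\<forall>x \<in> nonneg_orthant. K x \<in> psd_matrices"
    and M_psd: "\<forall>x \<in> nonneg_orthant. M x \<in> psd_matrices"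
    and K_cont: "continuous_on nonneg_orthant K"
    and M_cont: "continuous_on nonneg_orthant M"
    and K_pd: "\<forall>x \<in> pos_orthant. K x \<in> pd_matrices"
    and M_pd: "\<forall>x \<in> pos_orthant. M x \<in> pd_matrices"
    and phi: "\<forall>x \<in> nonneg_orthant. \<phi> x = lambda_max (M x) (K x)"
    and phie: "\<forall>\<epsilon> > 0. \<forall>x \<in> nonneg_orthant. \<phi>e \<epsilon> x = lambda_max (M x) (K x + \<epsilon> *\<^sub>R mat 1)"
  shows "(\<forall>\<epsilon> > 0. continuous_on nonneg_orthant (\<phi>e \<epsilon>)) \<and>
    epi_converges_at_0 (\<lambda>\<epsilon>. extend_by_infinity nonneg_orthant (\<phi>e \<epsilon>))
      (extend_by_infinity nonneg_orthant \<phi>)"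
proof (intro conjI allI impI)
  fix \<epsilon> :: real assume "0 < \<epsilon>"
  then have "continuous_on nonneg_orthant (\<lambda>x. lambda_max (M x) (K x + \<epsilon> *\<^sub>R mat 1))"
    using K_psd by (intro continuous_on_lambda_max pd_regularized continuous_intros K_cont M_cont) auto
  then show "continuous_on nonneg_orthant (\<phi>e \<epsilon>)"
    by (rule continuous_on_eq) (use phie \<open>0 < \<epsilon>\<close> in simp)
next
  let ?T = "epi (extend_by_infinity nonneg_orthant \<phi>)"
  let ?S = "\<lambda>\<epsilon>. epi (extend_by_infinity nonneg_orthant (\<phi>e \<epsilon>))"
  \<comment> \<open>Points outside the orthant drop out because \<infinity> is below no real
    \<alpha>.\<close>
  have T: "(x, \<alpha>) \<in> ?T \<longleftrightarrow> x \<in> nonneg_orthant \<and> 0 \<le> \<alpha> \<and>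
      (\<forall>v. v \<bullet> (M x *v v) \<le> \<alpha> * (v \<bullet> (K x *v v)))" for x \<alpha>
    using K_psd M_psd phi by (auto simp: epi_def extend_by_infinity_def lambda_max_le_iff)
  have S: "(x, \<alpha>) \<in> ?S \<epsilon> \<longleftrightarrow> x \<in> nonneg_orthant \<and> 0 \<le> \<alpha> \<and>
      (\<forall>v. v \<bullet> (M x *v v) \<le> \<alpha> * (v \<bullet> (K x *v v) + \<epsilon> * (v \<bullet> v)))" if "0 < \<epsilon>" for \<epsilon> x \<alpha>
    using K_psd M_psd phie that
    by (auto simp: epi_def extend_by_infinity_def lambda_max_le_iff psd_regularized
        quadratic_form_regularized)
  show "epi_converges_at_0 (\<lambda>\<epsilon>. extend_by_infinity nonneg_orthant (\<phi>e \<epsilon>))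
      (extend_by_infinity nonneg_orthant \<phi>)"
    unfolding epi_converges_at_0_def epi_converges_def PK_converges_def
  proof (intro allI impI, elim conjE)
    fix \<epsilon> :: "nat \<Rightarrow> real" assume pos: "\<forall>k. 0 < \<epsilon> k" and \<epsilon>: "\<epsilon> \<longlonglongrightarrow> 0"
    have "?T \<subseteq> ?S (\<epsilon> k)" for k
    proof safe
      fix x \<alpha> assume "(x, \<alpha>) \<in> ?T"
      moreover have "\<alpha> * a \<le> \<alpha> * (a + \<epsilon> k * (v \<bullet> v))" if "0 \<le> \<alpha>" for a and v :: "real ^ 'n"
        using that pos by (intro mult_left_mono) (simp_all add: less_imp_le)
      ultimately show "(x, \<alpha>) \<in> ?S (\<epsilon> k)"
        using pos by (auto simp: T S intro: order_trans)
    qed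
    then have inner: "?T \<subseteq> inner_limit (\<lambda>k. ?S (\<epsilon> k))"
      by (rule subset_inner_limit)
    have outer: "outer_limit (\<lambda>k. ?S (\<epsilon> k)) \<subseteq> ?T"
    proof safe
      fix x \<alpha> assume "(x, \<alpha>) \<in> outer_limit (\<lambda>k. ?S (\<epsilon> k))"
      then obtain r w where r: "filterlim r at_top sequentially"
        and w: "\<And>j. w j \<in> ?S (\<epsilon> (r j))" and lim: "w \<longlonglongrightarrow> (x, \<alpha>)"
        by (rule outer_limitE) blast
      define y \<beta> where "y = (\<lambda>j. fst (w j))" and "\<beta> = (\<lambda>j. snd (w j))"
      have y: "y \<longlonglongrightarrow> x" and \<beta>: "\<beta> \<longlonglongrightarrow> \<alpha>"
        using tendsto_fst[OF lim] tendsto_snd[OF lim] by (simp_all add: y_def \<beta>_def)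
      have "(y j, \<beta> j) \<in> ?S (\<epsilon> (r j))" for j
        using w by (simp add: y_def \<beta>_def)
      then have yD: "\<And>j. y j \<in> nonneg_orthant" and \<beta>0: "\<And>j. 0 \<le> \<beta> j"
        and le: "\<And>j v. v \<bullet> (M (y j) *v v) \<le> \<beta> j * (v \<bullet> (K (y j) *v v) + \<epsilon> (r j) * (v \<bullet> v))"
        using S pos by auto
      \<comment> \<open>Continuity of \<open>K\<close> and \<open>M\<close> is only relative to the
        orthant, so the limit point must first be placed there.\<close>
      have xD: "x \<in> nonneg_orthant"
        using closed_sequentially[OF closed_nonneg_orthant] yD y by blast
      have \<epsilon>r: "(\<lambda>j. \<epsilon> (r j)) \<longlonglongrightarrow> 0"
        using \<epsilon> r by (rule filterlim_compose)
      \<comment> \<open>The vector \<open>v\<close> stays fixed, so the constraints pass to the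
        limit one at a time and no uniformity in \<open>v\<close> arises.\<close>
      have lim_form: "(\<lambda>j. v \<bullet> (A (y j) *v v)) \<longlonglongrightarrow> v \<bullet> (A x *v v)"
        if "continuous_on nonneg_orthant A" for A :: "real ^ 'm \<Rightarrow> real ^ 'n ^ 'n" and v
        by (rule continuous_on_tendsto_compose[of nonneg_orthant "\<lambda>x. v \<bullet> (A x *v v)", OF _ y xD])
          (use yD that in \<open>auto intro!: continuous_intros\<close>)
      \<comment> \<open>The term \<open>0 * (v \<bullet> v)\<close> is kept so that the right-hand
        side is literally the limit given by the sum and product rules.\<close>
      have "v \<bullet> (M x *v v) \<le> \<alpha> * (v \<bullet> (K x *v v) + 0 * (v \<bullet> v))" for v
      proof (rule LIMSEQ_le[OF lim_form[OF M_cont]])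
        show "(\<lambda>j. \<beta> j * (v \<bullet> (K (y j) *v v) + \<epsilon> (r j) * (v \<bullet> v)))
            \<longlonglongrightarrow> \<alpha> * (v \<bullet> (K x *v v) + 0 * (v \<bullet> v))"
          by (intro tendsto_mult tendsto_add lim_form[OF K_cont] \<beta> \<epsilon>r tendsto_const)
      qed (use le in blast)
      moreover have "0 \<le> \<alpha>"
        using \<beta> \<beta>0 by (intro LIMSEQ_le_const) auto
      ultimately show "(x, \<alpha>) \<in> ?T"
        using xD by (simp add: T)
    qed
    \<comment> \<open>The inclusions close a cycle: \<open>?T\<close>, inner limit, outer limit,
      \<open>?T\<close>.\<close>
    show "outer_limit (\<lambda>k. ?S (\<epsilon> k)) = ?T \<and> inner_limit (\<lambda>k. ?S (\<epsilon> k)) = ?T"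
      using inner outer inner_limit_subset_outer_limit by blast
  qed
qed

end
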